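(* Let $A^\ast_{n,\ge m}$, $\xi_n$, $\alpha_j$ be taken from any one of the four families (Bernoulli, Cauchy, Euler, Euler of the second kind) described in the context, with the corresponding integer parameter $N$. For positive integers $n$ and $m$, we have $$A_{n,\ge m}^\ast=\xi_n\sum_{k=1}^n(-1)^{n-k}\sum_{\substack{i_1+\cdots+i_k=n\\ i_1,\dots,i_k\ge m}}\alpha_{i_1}\cdots\alpha_{i_k}.$$
   Context: $(x)^{(n)}=x(x+1)\cdots(x+n-1)$ for $n\ge1$ and $(x)^{(0)}=1$ (rising factorial). All identities below are between formal power series in $x$. For an integer $m\ge 1$ define the modified associated hypergeometric numbers by: - Bernoulli ($N\ge1$): $\left(1+\sum_{n=m}^{\infty}\frac{x^n}{(N+1)^{(n)}}\right)^{-1}=\sum_{n=0}^\infty B_{N,n,\ge m}^\ast\frac{x^n}{n!}$; - Cauchy ($N\ge1$): $\left(1+N\sum_{n=m}^{\infty}\frac{(-x)^n}{N+n}\right)^{-1}=\sum_{n=0}^\infty c_{N,n,\ge m}^\ast\frac{x^n}{n!}$; - Euler ($N\ge0$): $\left(1+\sum_{n=m}^{\infty}\frac{x^{2n}}{(2N+1)^{(2n)}}\right)^{-1}=\sum_{n=0}^\infty E_{N,n,\ge m}^\ast\frac{x^n}{n!}$; - Euler of the second kind ($N\ge0$): $\left(1+\sum_{n=m}^{\infty}\frac{x^{2n}}{(2N+2)^{(2n)}}\right)^{-1}=\sum_{n=0}^\infty\widehat E_{N,n,\ge m}^\ast\frac{x^n}{n!}$. The symbols $A^\ast_{n,\ge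 m}$, $\xi_n$ ($n\ge0$), $\alpha_j$ ($j\ge1$) denote simultaneously one of the following choices ($N$ is suppressed from the notation): - Bernoulli: $A^\ast_{n,\ge m}=B^\ast_{N,n,\ge m}$, $\xi_n=(-1)^n n!$, $\alpha_j=\frac{N!}{(N+j)!}$, $N\ge1$; - Cauchy: $A^\ast_{n,\ge m}=c^\ast_{N,n,\ge m}$, $\xi_n=n!$, $\alpha_j=\frac{N}{N+j}$, $N\ge1$; - Euler: $A^\ast_{n,\ge m}=E^\ast_{N,2n,\ge m}$, $\xi_n=(-1)^n(2n)!$, $\alpha_j=\frac{(2N)!}{(2N+2j)!}$, $N\ge0$; - Euler of the second kind: $A^\ast_{n,\ge m}=\widehat E^\ast_{N,2n,\ge m}$, $\xi_n=(-1)^n(2n)!$, $\alpha_j=\frac{(2N+1)!}{(2N+2j+1)!}$, $N\ge0$. Inner sums run over ordered $k$-tuples of integers; empty sums are $0$. *)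

theory Defs
  imports "HOL-Computational_Algebra.Formal_Power_Series"
begin

text \<open>
  The parameters are \<open>N\<close>, \<open>m\<close>, and the index \<open>n\<close>, in this order. The tail sums starting at \<open>m\<close> are
  given by their coefficient sequences. For \<open>m \<ge> 1\<close> the inverted series has constant term 1, so
  \<^const>\<open>inverse\<close> is its reciprocal in the ring of formal power series. The rising factorial is
  \<^const>\<open>pochhammer\<close>.
\<close>

definition bernoulli_assoc :: "nat \<Rightarrow> nat \<Rightarrow> nat \<Rightarrow> rat" where
  "bernoulli_assoc N m n =
     fact n * fps_nth (inverse (1 + Abs_fps (\<lambda>i.
       if m \<le> i then 1 / pochhammer (of_nat (N + 1)) i else 0))) n"

definition cauchy_assoc :: "nat \<Rightarrow> nat \<Rightarrow> nat \<Rightarrow> rat" where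
  "cauchy_assoc N m n =
     fact n * fps_nth (inverse (1 + fps_const (of_nat N) * Abs_fps (\<lambda>i.
       if m \<le> i then (-1) ^ i / of_nat (N + i) else 0))) n"

text \<open>
  In the next two series the coefficient of the \<open>i\<close>-th power vanishes unless \<open>i = 2 * l\<close> with
  \<open>m \<le> l\<close>.
\<close>

definition euler_assoc :: "nat \<Rightarrow> nat \<Rightarrow> nat \<Rightarrow> rat" where
  "euler_assoc N m n =
     fact n * fps_nth (inverse (1 + Abs_fps (\<lambda>i.
       if even i \<and> 2 * m \<le> i then 1 / pochhammer (of_nat (2 * N + 1)) i else 0))) n"

definition euler2_assoc :: "nat \<Rightarrow> nat \<Rightarrow> nat \<Rightarrow> rat" where
  "euler2_assoc N m n =
     fact n * fps_nth (inverse (1 + Abs_fps (\<lambda>i.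
       if even i \<and> 2 * m \<le> i then 1 / pochhammer (of_nat (2 * N + 2)) i else 0))) n"

datatype family = Bernoulli | Cauchy | Euler | Euler2

primrec N_min :: "family \<Rightarrow> nat" where
  "N_min Bernoulli = 1"
| "N_min Cauchy = 1"
| "N_min Euler = 0"
| "N_min Euler2 = 0"

primrec A_star :: "family \<Rightarrow> nat \<Rightarrow> nat \<Rightarrow> nat \<Rightarrow> rat" where
  "A_star Bernoulli N m n = bernoulli_assoc N m n"
| "A_star Cauchy N m n = cauchy_assoc N m n"
| "A_star Euler N m n = euler_assoc N m (2 * n)"
| "A_star Euler2 N m n = euler2_assoc N m (2 * n)"

primrec xi :: "family \<Rightarrow> nat \<Rightarrow> rat" where
  "xi Bernoulli n = (-1) ^ n * fact n"
| "xi Cauchy n = fact n"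
| "xi Euler n = (-1) ^ n * fact (2 * n)"
| "xi Euler2 n = (-1) ^ n * fact (2 * n)"

primrec alpha :: "family \<Rightarrow> nat \<Rightarrow> nat \<Rightarrow> rat" where
  "alpha Bernoulli N j = fact N / fact (N + j)"
| "alpha Cauchy N j = of_nat N / of_nat (N + j)"
| "alpha Euler N j = fact (2 * N) / fact (2 * N + 2 * j)"
| "alpha Euler2 N j = fact (2 * N + 1) / fact (2 * N + 2 * j + 1)"

definition tuples :: "nat \<Rightarrow> nat \<Rightarrow> nat \<Rightarrow> nat list set" where
  "tuples k m n = {t. length t = k \<and> sum_list t = n \<and> (\<forall>i\<in>set t. m \<le> i)}"

lemma finite_tuples: "finite (tuples k m n)"
proof (rule finite_subset)
  show "tuples k m n \<subseteq> {t. set t \<subseteq> {..n} \<and> length t = k}"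
    using member_le_sum_list by (fastforce simp: tuples_def)
  show "finite {t. set t \<subseteq> {..n} \<and> length t = k}"
    by (rule finite_lists_length_eq) simp
qed

end

theory Submission
  imports Defs
begin

text \<open>
  In each of the four families the inverted series is \<open>1 + G\<close> with \<open>G\<close> having no constant term
  (this is where \<open>m \<ge> 1\<close> enters), so its reciprocal is the geometric series \<open>\<Sum>k (-1)\<^sup>k G\<^sup>k\<close>. Only the
  powers with \<open>k \<le> n\<close> reach the coefficient of \<open>x\<^sup>n\<close>, and \<open>k = 0\<close> contributes nothing for
  \<open>n \<ge> 1\<close>. Expanding \<open>G\<^sup>k\<close> as a \<open>k\<close>-fold Cauchy product turns its \<open>n\<close>-th coefficient into the
  sum over \<open>k\<close>-tuples of indices \<open>\<ge> m\<close> adding up to \<open>n\<close>. This is the lemma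
  \<open>inverse_one_plus_tail_nth\<close>.

  The families differ from it only superficially. For Bernoulli numbers the coefficients of \<open>G\<close> are
  exactly \<open>\<alpha>\<^sub>j\<close>. For Cauchy numbers they are \<open>(-1)\<^sup>j \<alpha>\<^sub>j\<close>, and as the entries of a tuple add up to
  \<open>n\<close>, the signs multiply to \<open>(-1)\<^sup>n\<close>; this is why \<open>\<xi>\<^sub>n\<close> carries no sign in that case. For both
  kinds of Euler numbers \<open>G\<close> is a series with coefficients \<open>\<alpha>\<^sub>j\<close> evaluated at \<open>x\<^sup>2\<close>, and
  substituting \<open>x\<^sup>2\<close> commutes with taking reciprocals, so the coefficient of index \<open>2 n\<close> is the one
  of index \<open>n\<close> before the substitution.
\<close>

lemma fps_tail_power_nth:
  fixes a :: "nat \<Rightarrow> 'a::comm_ring_1"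
  shows "fps_nth (Abs_fps (\<lambda>i. if m \<le> i then a i else 0) ^ k) n =
    (\<Sum>t\<in>tuples k m n. prod_list (map a t))"
proof -
  let ?b = "\<lambda>i. if m \<le> i then a i else 0"
  have "fps_nth (Abs_fps ?b ^ k) n = (\<Sum>t\<in>natpermute n k. prod_list (map ?b t))"
  proof (cases k)
    case 0
    then show ?thesis
      by (auto simp: natpermute_0)
  next
    case (Suc l)
    have "(\<Prod>j = 0..l. ?b (t ! j)) = prod_list (map ?b t)" if "t \<in> natpermute n k" for t
      using that Suc
      by (simp add: prod.list_conv_set_nth natpermute_def atLeastLessThanSuc_atLeastAtMost)
    then show ?thesis
      unfolding fps_power_nth by (simp add: Suc del: power_Suc)
  qed
  \<comment> \<open>A tuple with an entry below \<open>m\<close> has a vanishing factor.\<close>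
  also have "\<dots> = (\<Sum>t\<in>tuples k m n. prod_list (map ?b t))"
  proof (rule sum.mono_neutral_right)
    show "finite (natpermute n k)"
      by (rule natpermute_finite)
    show "tuples k m n \<subseteq> natpermute n k"
      by (auto simp: tuples_def natpermute_def)
    show "\<forall>t\<in>natpermute n k - tuples k m n. prod_list (map ?b t) = 0"
    proof
      fix t assume "t \<in> natpermute n k - tuples k m n"
      then obtain i where "i \<in> set t" "\<not> m \<le> i"
        by (auto simp: tuples_def natpermute_def)
      then have "?b i = 0" and "?b i dvd prod_list (map ?b t)"
        by (simp, intro prod_list_dvd) (auto simp: image_iff)
      then show "prod_list (map ?b t) = 0"
        by simp
    qed
  qed
  also have "\<dots> = (\<Sum>t\<in>tuples k m n. prod_list (map a t))"
    by (intro sum.cong refl arg_cong[where f = prod_list] map_cong) (auto simp: tuples_def)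
  finally show ?thesis .
qed

text \<open>
  The partial geometric sum satisfies \<open>(1 + G) S = 1 - (-G)\<^bsup>n+1\<^esup>\<close>, so it differs from the reciprocal
  of \<open>1 + G\<close> by a multiple of \<open>G\<^bsup>n+1\<^esup>\<close>, which starts beyond the \<open>n\<close>-th coefficient.
\<close>

lemma fps_inverse_one_plus_nth:
  fixes G :: "'a::field fps"
  assumes "fps_nth G 0 = 0"
  shows "fps_nth (inverse (1 + G)) n = (\<Sum>k\<le>n. (-1) ^ k * fps_nth (G ^ k) n)"
proof -
  let ?S = "\<Sum>k\<le>n. (- G) ^ k" and ?I = "inverse (1 + G)"
  have I: "?I * (1 + G) = 1"
    by (rule inverse_mult_eq_1) (simp add: assms)
  have "1 - (- G) ^ Suc n = (1 + G) * ?S"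
    by (simp add: one_diff_power_eq lessThan_Suc_atMost del: power_Suc)
  then have "?I * (1 - (- G) ^ Suc n) = ?S"
    using I by (simp add: mult.assoc[symmetric] del: power_Suc)
  then have "?I = ?S + (- G) ^ Suc n * ?I"
    by (simp add: algebra_simps del: power_Suc)
  moreover have "fps_nth ((- G) ^ Suc n * ?I) n = 0"
  proof -
    have "fps_nth ((- G) ^ Suc n) i = 0" if "i \<le> n" for i
      using startsby_zero_power_prefix[of "- G" "Suc n"] assms that by auto
    then show ?thesis
      by (simp add: fps_mult_nth del: power_Suc)
  qed
  ultimately have "fps_nth ?I n = fps_nth ?S n"
    by (metis add.right_neutral fps_add_nth)
  also have "\<dots> = (\<Sum>k\<le>n. (-1) ^ k * fps_nth (G ^ k) n)"
  proof -
    have "fps_nth ((- G) ^ k) n = (-1) ^ k * fps_nth (G ^ k) n" for k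
      by (cases "even k") simp_all
    then show ?thesis
      by (simp add: fps_sum_nth)
  qed
  finally show ?thesis .
qed

lemma inverse_one_plus_tail_nth:
  fixes a :: "nat \<Rightarrow> 'a::field"
  assumes "m \<ge> 1" and "n \<ge> 1"
  shows "fps_nth (inverse (1 + Abs_fps (\<lambda>i. if m \<le> i then a i else 0))) n =
    (\<Sum>k=1..n. (-1) ^ k * (\<Sum>t\<in>tuples k m n. prod_list (map a t)))"
proof -
  let ?G = "Abs_fps (\<lambda>i. if m \<le> i then a i else 0)"
  have "fps_nth (inverse (1 + ?G)) n = (\<Sum>k\<le>n. (-1) ^ k * fps_nth (?G ^ k) n)"
    using assms by (intro fps_inverse_one_plus_nth) simp
  also have "\<dots> = (\<Sum>k=1..n. (-1) ^ k * fps_nth (?G ^ k) n)"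
    using assms by (intro sum.mono_neutral_right) (auto simp: not_le)
  finally show ?thesis
    by (simp only: fps_tail_power_nth)
qed

lemma fps_nth_compose_X_square:
  fixes f :: "'a::comm_ring_1 fps"
  shows "fps_nth (f oo fps_X ^ 2) n = (if even n then fps_nth f (n div 2) else 0)"
proof -
  have "fps_nth (f oo fps_X ^ 2) n = (\<Sum>i=0..n. if n = 2 * i then fps_nth f i else 0)"
    unfolding fps_compose_nth power_mult[symmetric]
    by (intro sum.cong) (auto simp: fps_X_power_nth)
  also have "\<dots> = (\<Sum>i=0..n. if even n \<and> i = n div 2 then fps_nth f i else 0)"
    by (intro sum.cong) auto
  also have "\<dots> = (if even n then fps_nth f (n div 2) else 0)"
    by (simp add: sum.delta)
  finally show ?thesis .
qed

text \<open>
  The series is the one with coefficients \<open>b (2 * j)\<close> for \<open>j \<ge> m\<close>, composed with \<open>x\<^sup>2\<close>. Composition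
  preserves reciprocals, which reduces both Euler families to \<open>inverse_one_plus_tail_nth\<close>.
\<close>

lemma inverse_one_plus_even_tail_nth:
  fixes b :: "nat \<Rightarrow> 'a::field"
  assumes "m \<ge> 1" and "n \<ge> 1"
  shows "fps_nth (inverse (1 + Abs_fps (\<lambda>i. if even i \<and> 2 * m \<le> i then b i else 0))) (2 * n) =
    (\<Sum>k=1..n. (-1) ^ k * (\<Sum>t\<in>tuples k m n. prod_list (map (\<lambda>j. b (2 * j)) t)))"
proof -
  let ?G = "Abs_fps (\<lambda>j. if m \<le> j then b (2 * j) else 0)"
  let ?H = "Abs_fps (\<lambda>i. if even i \<and> 2 * m \<le> i then b i else 0)"
  have "?H = ?G oo fps_X ^ 2"
    by (rule fps_ext) (auto simp: fps_nth_compose_X_square elim!: evenE)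
  then have "1 + ?H = (1 + ?G) oo fps_X ^ 2"
    by (simp add: fps_compose_add_distrib)
  then have "inverse (1 + ?H) = inverse (1 + ?G) oo fps_X ^ 2"
    using assms by (simp add: fps_inverse_compose)
  then have "fps_nth (inverse (1 + ?H)) (2 * n) = fps_nth (inverse (1 + ?G)) n"
    by (simp add: fps_nth_compose_X_square)
  then show ?thesis
    by (simp only: inverse_one_plus_tail_nth[OF assms])
qed

lemma inverse_pochhammer_eq_fact_quotient:
  "1 / pochhammer (of_nat (Suc M)) i = (fact M / fact (M + i) :: 'a::field_char_0)"
proof -
  have "(fact (M + i) :: 'a) = fact M * pochhammer (of_nat (Suc M)) i"
    using pochhammer_product'[of "1 :: 'a" M i]
    by (simp add: pochhammer_fact add.commute)
  then show ?thesis
    by simp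
qed

lemma prod_list_map_alternating:
  fixes a :: "nat \<Rightarrow> 'a::comm_ring_1"
  shows "prod_list (map (\<lambda>i. (-1) ^ i * a i) t) = (-1) ^ sum_list t * prod_list (map a t)"
  by (induction t) (simp_all add: power_add algebra_simps)

theorem proposition6:
  fixes F :: family and N n m :: nat
  assumes "N \<ge> N_min F" and "n \<ge> 1" and "m \<ge> 1"
  shows "A_star F N m n =
    xi F n * (\<Sum>k=1..n. (-1) ^ (n - k) * (\<Sum>t\<in>tuples k m n. prod_list (map (alpha F N) t)))"
proof -
  let ?T = "\<lambda>k. \<Sum>t\<in>tuples k m n. prod_list (map (alpha F N) t)"
  have "(-1) ^ (n - k) = (-1) ^ n * ((-1) ^ k :: rat)" if "k \<in> {1..n}" for k
    using that by (simp add: minus_one_power_iff)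
  then have sign: "(\<Sum>k=1..n. (-1) ^ (n - k) * ?T k) = (-1) ^ n * (\<Sum>k=1..n. (-1) ^ k * ?T k)"
    unfolding sum_distrib_left by (intro sum.cong) (simp_all add: mult.assoc)
  \<comment> \<open>Outside the Cauchy case, the sign of \<open>\<xi>\<^sub>n\<close> cancels the factor \<open>(-1)\<^sup>n\<close> just extracted.\<close>
  have cancel: "(-1) ^ n * x * ((-1) ^ n * y) = x * y" for x y :: rat
    by (simp add: minus_one_power_iff)
  show ?thesis
  proof (cases F)
    case Bernoulli
    have "1 / pochhammer (of_nat (N + 1)) i = alpha F N i" for i
      using inverse_pochhammer_eq_fact_quotient[of N i] by (simp add: Bernoulli)
    then have "A_star F N m n = fact n * (\<Sum>k=1..n. (-1) ^ k * ?T k)"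
      by (simp only: Bernoulli A_star.simps bernoulli_assoc_def
          inverse_one_plus_tail_nth[OF assms(3,2)])
    then show ?thesis
      unfolding sign by (simp only: Bernoulli xi.simps cancel)
  next
    case Cauchy
    have "fps_const (of_nat N) * Abs_fps (\<lambda>i. if m \<le> i then (-1) ^ i / of_nat (N + i) else 0) =
      Abs_fps (\<lambda>i. if m \<le> i then (-1) ^ i * alpha F N i else 0)"
      by (rule fps_ext) (simp add: Cauchy)
    then have "A_star F N m n = fact n * (\<Sum>k=1..n. (-1) ^ k *
        (\<Sum>t\<in>tuples k m n. prod_list (map (\<lambda>i. (-1) ^ i * alpha F N i) t)))"
      by (simp only: Cauchy A_star.simps cauchy_assoc_def
          inverse_one_plus_tail_nth[OF assms(3,2)])
    moreover have "(\<Sum>t\<in>tuples k m n. prod_list (map (\<lambda>i. (-1) ^ i * alpha F N i) t)) =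
        (-1) ^ n * ?T k" for k
      unfolding prod_list_map_alternating sum_distrib_left
      by (intro sum.cong) (simp_all add: tuples_def)
    moreover have "(\<Sum>k=1..n. (-1) ^ k * ((-1) ^ n * ?T k)) =
        (-1) ^ n * (\<Sum>k=1..n. (-1) ^ k * ?T k)"
      by (simp only: sum_distrib_left mult.left_commute)
    ultimately show ?thesis
      unfolding sign by (simp only: Cauchy xi.simps)
  next
    case Euler
    have "1 / pochhammer (of_nat (2 * N + 1)) (2 * j) = alpha F N j" for j
      using inverse_pochhammer_eq_fact_quotient[of "2 * N" "2 * j"] by (simp add: Euler)
    then have "A_star F N m n = fact (2 * n) * (\<Sum>k=1..n. (-1) ^ k * ?T k)"
      by (simp only: Euler A_star.simps euler_assoc_def
          inverse_one_plus_even_tail_nth[OF assms(3,2)])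
    then show ?thesis
      unfolding sign by (simp only: Euler xi.simps cancel)
  next
    case Euler2
    have "1 / pochhammer (of_nat (2 * N + 2)) (2 * j) = alpha F N j" for j
      using inverse_pochhammer_eq_fact_quotient[of "2 * N + 1" "2 * j"]
      by (simp add: Euler2 add.assoc)
    then have "A_star F N m n = fact (2 * n) * (\<Sum>k=1..n. (-1) ^ k * ?T k)"
      by (simp only: Euler2 A_star.simps euler2_assoc_def
          inverse_one_plus_even_tail_nth[OF assms(3,2)])
    then show ?thesis
      unfolding sign by (simp only: Euler2 xi.simps cancel)
  qed
qed

end
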